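(* Let $\ell:[0,\infty)\to V_1$ be continuous and of bounded variation on compact intervals, and for $T>0$ put $\ell_T(u)=(\ell(Tu)-\ell(0))/T$, $0\le u\le1$. If $\ell_T\to\ell^\infty$ uniformly on $[0,1]$ as $T\to\infty$, then $$\ell^\infty(u)=u\mu,\qquad 0\le u\le1,$$ where $\mu=\ell^\infty(1)$.
   Context: $V_1$ is the first layer of a finite-dimensional real graded nilpotent Lie algebra; here it is just a finite-dimensional real normed vector space. The limit $T\to\infty$ is over the full family of real $T$, not along a subsequence. *)

theory Defs
  imports "HOL-Analysis.Analysis"
begin

text \<open>Finite-dimensionality of the whole type, independent of any inner product or choice of norm.\<close>

definition finite_dimensional :: "'a::real_vector itself \<Rightarrow> bool"
  where "finite_dimensional _ \<longleftrightarrow>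
    (\<exists>B. finite_dimensional_vector_space (scaleR :: real \<Rightarrow> 'a \<Rightarrow> 'a) B)"

text \<open>
  A partition of \<open>[a, b]\<close> is given by points \<open>t 0 \<le> \<dots> \<le> t n\<close>; repeated points are harmless,
  since they contribute nothing to the sum.
\<close>

definition bounded_variation_on :: "real \<Rightarrow> real \<Rightarrow> (real \<Rightarrow> 'a::real_normed_vector) \<Rightarrow> bool"
  where "bounded_variation_on a b f \<longleftrightarrow>
    (\<exists>C. \<forall>n (t :: nat \<Rightarrow> real).
       t 0 = a \<and> t n = b \<and> (\<forall>i<n. t i \<le> t (Suc i)) \<longrightarrow>
       (\<Sum>i<n. norm (f (t (Suc i)) - f (t i))) \<le> C)"

definition rescaled_path :: "(real \<Rightarrow> 'a::real_normed_vector) \<Rightarrow> real \<Rightarrow> real \<Rightarrow> 'a"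
  where "rescaled_path l T u = (l (T * u) - l 0) /\<^sub>R T"

end

theory Submission
  imports Defs
begin

text \<open>Self-similarity: stopping at time \<open>u\<close> on scale \<open>T\<close> is the same
  as reaching the endpoint on scale \<open>u * T\<close>, up to the factor \<open>u\<close>
  (\<open>rescaled_path_scale\<close>). For \<open>u > 0\<close> both scales tend to infinity
  together, so the limit at \<open>u\<close> is \<open>u\<close> times the limit at 1.\<close>

lemma rescaled_path_scale:
  "rescaled_path l T u = u *\<^sub>R rescaled_path l (u * T) 1"
  \<comment> \<open>No condition on \<open>T\<close>: at \<open>T = 0\<close> both sides vanish
    since \<open>inverse 0 = 0\<close>.\<close>
  by (cases "u = 0") (simp_all add: rescaled_path_def mult.commute)

theorem proposition3p5:
  fixes l l_inf :: "real \<Rightarrow> 'V::real_normed_vector" and \<mu> :: 'V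
  assumes "finite_dimensional TYPE('V)"
    and "continuous_on {0..} l"
    and "\<And>a b. 0 \<le> a \<Longrightarrow> a \<le> b \<Longrightarrow> bounded_variation_on a b l"
    and "uniform_limit {0..1} (rescaled_path l) l_inf at_top"
    and "\<mu> = l_inf 1"
  shows "\<forall>u\<in>{0..1}. l_inf u = u *\<^sub>R \<mu>"
proof
  fix u :: real
  assume u: "u \<in> {0..1}"
  have lim: "((\<lambda>T. rescaled_path l T v) \<longlongrightarrow> l_inf v) at_top" if "v \<in> {0..1}" for v
    using assms(4) that by (rule tendsto_uniform_limitI)
  have "((\<lambda>T. rescaled_path l T u) \<longlongrightarrow> u *\<^sub>R l_inf 1) at_top"
  \<comment> \<open>At \<open>u = 0\<close> the scale \<open>u * T\<close> stays at 0, but the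
    rescaled path is identically 0 there.\<close>
  proof (cases "u = 0")
    case True
    then show ?thesis by (simp add: rescaled_path_def)
  next
    case False
    with u have "filterlim (\<lambda>T. u * T) at_top at_top"
      by (intro filterlim_tendsto_pos_mult_at_top[OF tendsto_const _ filterlim_ident]) auto
    \<comment> \<open>Convergence along all real \<open>T\<close> permits the substitution of
      \<open>u * T\<close> for \<open>T\<close>.\<close>
    then have "((\<lambda>T. rescaled_path l (u * T) 1) \<longlongrightarrow> l_inf 1) at_top"
      using filterlim_compose[OF lim[of 1]] by simp
    then show ?thesis
      by (subst rescaled_path_scale) (intro tendsto_intros)
  qed
  with lim[OF u] show "l_inf u = u *\<^sub>R \<mu>"
    unfolding assms(5) by (intro tendsto_unique) simp_all
qed

end
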